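(* Let $b\in\mathbb N$, $k,d,\ell\in\mathbb N_+$ with $k\ge3$, $b+\ell\ge2$, and set $n=b(k+1)+\ell k+d$. Choose $t\in\mathbb N$ with $2\le t\le\min(k-1,d+1)$, set $a=b+(b+\ell)(k-t)+t-1$, and decompose $n-a=ct+r$ with $0\le r<t$ and $c\in\mathbb N$. Then $g=((k+1)^{[b]},k^{[\ell]},1^{[d]})\in\mathcal J(\mathcal L_n)$, $m=(a,t^{[c]},r)\in\mathcal M(\mathcal L_n)$ is of type IV, and both $g\swarrow m$ and $g\nearrow m$ hold. Moreover, if $g\in\mathcal J(\mathcal L_n)$ is of type D and $m\in\mathcal M(\mathcal L_n)$ satisfies both $g\swarrow m$ and $g\nearrow m$, then $m$ is of the shape just described: writing $g=((k+1)^{[b]},k^{[\ell]},1^{[d]})$ with $b\in\mathbb N$, $k,d,\ell\in\mathbb N_+$, $k\ge3$, $b+\ell\ge2$, there is $t$ with $2\le t\le\min(k-1,d+1)$ such that $m=(a,t^{[c]},r)$ where $a=b+(b+\ell)(k-t)+t-1$ and $n-a=ct+r$ with $c\in\mathbb N$, $0\le r<t$.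
   Context: $\mathbb N=\{0,1,2,\dots\}$, $\mathbb N_+=\mathbb N\setminus\{0\}$. A partition of $n\in\mathbb N$ is a tuple $(a_1,\dots,a_n)$ of natural numbers with $a_1\ge\dots\ge a_n\ge 0$ and $\sum a_i=n$; trailing zeros may be omitted or added. $x^{[s]}$ denotes $s$ consecutive entries equal to $x$ (no entry if $s=0$). $\mathcal L_n$ is the finite lattice of all partitions of $n$ under the dominance order: $a\le b$ iff $\sum_{i=1}^j a_i\le\sum_{i=1}^j b_i$ for all $1\le j\le n$. $\mathcal J(\mathcal L_n)$ is the set of (completely) join-irreducible elements (not the least element, and $x=y\vee z$ implies $x=y$ or $x=z$); $\mathcal M(\mathcal L_n)$ is the set of (completely) meet-irreducible elements (not the greatest element, and $x=y\wedge z$ implies $x=y$ or $x=z$). Arrow relations of the standard context $(\mathcal J(\mathcal L_n),\mathcal M(\mathcal L_n),\le)$: for $g\in\mathcal J(\mathcal L_n)$ and $m\in\mathcal M(\mathcal L_n)$ put $g'=\{y\in\mathcal M(\mathcal L_n): g\le y\}$ and $m'=\{y\in\mathcal J(\mathcal L_n): y\le m\}$. Then $g\swarrow m$ iff $g\nleq m$ and for all $h\in\mathcal J(\mathcal L_n)$ with $g'\subsetneq h'$ we have $h\le m$; and $g\nearrow m$ iff $g\nleq m$ and for all $y\in\mathcal M(\mathcal L_n)$ with $m'\subsetneq y'$ we have $g\le y$. Types of partitions of $n$: an element of $\mathcal J(\mathcal L_n)$ is of type D if it is $((k+1)^{[b]},k^{[\ell]},1^{[d]})$ with $b\in\mathbb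 N$, $\ell,d\in\mathbb N_+$, $k\ge3$, $b+\ell\ge2$; an element of $\mathcal M(\mathcal L_n)$ is of type IV if it is $(a,t^{[c]},r)$ with $a>t>r\ge0$ and $t,c\ge2$. *)

theory Defs
  imports "HOL-Algebra.Lattice"
begin

section \<open>The lattice of partitions of n under dominance\<close>

text \<open>A partition of \<open>n\<close> is an \<open>n\<close>-tuple, represented as a list of length exactly \<open>n\<close>
  (so trailing zeros are always written out).\<close>

definition partitions :: "nat \<Rightarrow> nat list set" where
  "partitions n = {xs. length xs = n \<and> sorted_wrt (\<ge>) xs \<and> sum_list xs = n}"

definition dominated :: "nat \<Rightarrow> nat list \<Rightarrow> nat list \<Rightarrow> bool" where
  "dominated n xs ys \<longleftrightarrow> (\<forall>j\<in>{1..n}. sum_list (take j xs) \<le> sum_list (take j ys))"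

definition partition_lattice :: "nat \<Rightarrow> nat list gorder" where
  "partition_lattice n = \<lparr>carrier = partitions n, eq = (=), le = dominated n\<rparr>"

text \<open>\<open>tuple n xs\<close> is the \<open>n\<close>-tuple denoted by \<open>xs\<close> when trailing zeros have been omitted.
  If \<open>xs\<close> is longer than \<open>n\<close> nothing is cut off, and the result is not in \<open>partitions n\<close>.\<close>

definition tuple :: "nat \<Rightarrow> nat list \<Rightarrow> nat list" where
  "tuple n xs = xs @ replicate (n - length xs) 0"


section \<open>Irreducible elements and arrow relations\<close>

definition join_irreducibles :: "('a, 'b) gorder_scheme \<Rightarrow> 'a set" where
  "join_irreducibles L = {x \<in> carrier L. \<not> least L x (carrier L) \<and>
     (\<forall>y\<in>carrier L. \<forall>z\<in>carrier L. x = y \<squnion>\<^bsub>L\<^esub> z \<longrightarrow> x = y \<or> x = z)}"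

definition meet_irreducibles :: "('a, 'b) gorder_scheme \<Rightarrow> 'a set" where
  "meet_irreducibles L = {x \<in> carrier L. \<not> greatest L x (carrier L) \<and>
     (\<forall>y\<in>carrier L. \<forall>z\<in>carrier L. x = y \<sqinter>\<^bsub>L\<^esub> z \<longrightarrow> x = y \<or> x = z)}"

text \<open>The derivations \<open>g'\<close> and \<open>m'\<close> in the standard context of \<open>L\<close>.\<close>

definition intent :: "('a, 'b) gorder_scheme \<Rightarrow> 'a \<Rightarrow> 'a set" where
  "intent L g = {y \<in> meet_irreducibles L. g \<sqsubseteq>\<^bsub>L\<^esub> y}"

definition extent :: "('a, 'b) gorder_scheme \<Rightarrow> 'a \<Rightarrow> 'a set" where
  "extent L m = {y \<in> join_irreducibles L. y \<sqsubseteq>\<^bsub>L\<^esub> m}"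

text \<open>Both arrows are meant for \<open>g \<in> join_irreducibles L\<close> and \<open>m \<in> meet_irreducibles L\<close> only.\<close>

definition down_arrow :: "('a, 'b) gorder_scheme \<Rightarrow> 'a \<Rightarrow> 'a \<Rightarrow> bool"
    (\<open>(_ \<swarrow>\<index> _)\<close> [51, 51] 50) where
  "g \<swarrow>\<^bsub>L\<^esub> m \<longleftrightarrow> \<not> g \<sqsubseteq>\<^bsub>L\<^esub> m \<and>
     (\<forall>h\<in>join_irreducibles L. intent L g \<subset> intent L h \<longrightarrow> h \<sqsubseteq>\<^bsub>L\<^esub> m)"

definition up_arrow :: "('a, 'b) gorder_scheme \<Rightarrow> 'a \<Rightarrow> 'a \<Rightarrow> bool"
    (\<open>(_ \<nearrow>\<index> _)\<close> [51, 51] 50) where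
  "g \<nearrow>\<^bsub>L\<^esub> m \<longleftrightarrow> \<not> g \<sqsubseteq>\<^bsub>L\<^esub> m \<and>
     (\<forall>y\<in>meet_irreducibles L. extent L m \<subset> extent L y \<longrightarrow> g \<sqsubseteq>\<^bsub>L\<^esub> y)"


section \<open>Types of irreducible partitions\<close>

definition shape_D :: "nat \<Rightarrow> nat \<Rightarrow> nat \<Rightarrow> nat \<Rightarrow> nat list" where
  "shape_D b k l d = replicate b (k + 1) @ replicate l k @ replicate d 1"

definition shape_IV :: "nat \<Rightarrow> nat \<Rightarrow> nat \<Rightarrow> nat \<Rightarrow> nat list" where
  "shape_IV a t c r = [a] @ replicate c t @ [r]"

definition type_D :: "nat \<Rightarrow> nat list \<Rightarrow> bool" where
  "type_D n g \<longleftrightarrow> g \<in> join_irreducibles (partition_lattice n) \<and>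
     (\<exists>b k l d. l \<ge> 1 \<and> d \<ge> 1 \<and> k \<ge> 3 \<and> b + l \<ge> 2 \<and> g = tuple n (shape_D b k l d))"

definition type_IV :: "nat \<Rightarrow> nat list \<Rightarrow> bool" where
  "type_IV n m \<longleftrightarrow> m \<in> meet_irreducibles (partition_lattice n) \<and>
     (\<exists>a t c r. a > t \<and> t > r \<and> t \<ge> 2 \<and> c \<ge> 2 \<and> m = tuple n (shape_IV a t c r))"

end

theory Submission
  imports Defs "HOL-Algebra.Complete_Lattice"
begin

text \<open>In a finite lattice, \<open>g \<swarrow> m\<close> and \<open>g \<nearrow> m\<close> together say that \<open>m\<close> is maximal among the
  elements not above \<open>g\<close> and that \<open>g\<close> is minimal among the elements not below \<open>m\<close>. Let \<open>g\<close> be of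
  type D, \<open>p = b + l\<close>, and let \<open>q + 1\<close> be the sum of the first \<open>p\<close> entries of \<open>g\<close>. Since \<open>g\<close> is as
  flat as possible both on its first \<open>p\<close> entries and on the remaining ones, a partition lies above
  \<open>g\<close> iff its first \<open>p\<close> entries sum to at least \<open>q + 1\<close>. The partial sums of a partition form a
  concave function, so one with \<open>p\<close>-th partial sum \<open>q\<close> lies below a tangent line \<open>q + (j - p) t\<close>;
  the partitions \<open>(a, t\<^sup>c, r)\<close> are those whose partial sums follow such a line, cut off at \<open>n\<close>.
  So they are maximal among the partitions not above \<open>g\<close>, and the bounds on \<open>t\<close> express that they
  lie above the unique lower cover of \<open>g\<close>.\<close>

section \<open>Arrows in finite lattices\<close>

text \<open>If \<open>m = y \<sqinter> z\<close> with \<open>y\<close> and \<open>z\<close> both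
  different from \<open>m\<close>, maximality puts both above \<open>g\<close>, hence
  \<open>m\<close> above \<open>g\<close>, a contradiction.\<close>

lemma (in lattice) meet_irreducible_if_maximal_not_above:
  assumes "g \<in> carrier L" "m \<in> carrier L" "\<not> g \<sqsubseteq> m"
    and max: "\<And>x. x \<in> carrier L \<Longrightarrow> m \<sqsubseteq> x \<Longrightarrow> x \<noteq> m \<Longrightarrow> g \<sqsubseteq> x"
  shows "m \<in> meet_irreducibles L"
proof -
  have "m = y \<or> m = z" if "y \<in> carrier L" "z \<in> carrier L" "m = y \<sqinter> z" for y z
    using meet_left[of y z] meet_right[of y z] meet_le[of g y z] max[of y] max[of z] assms that
    by metis
  moreover have "\<not> greatest L m (carrier L)"
    using assms by (auto simp: greatest_def)
  ultimately show ?thesis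
    using assms by (auto simp: meet_irreducibles_def)
qed

lemma (in lattice) join_irreducible_if_minimal_not_below:
  assumes "g \<in> carrier L" "m \<in> carrier L" "\<not> g \<sqsubseteq> m"
    and min: "\<And>x. x \<in> carrier L \<Longrightarrow> x \<sqsubseteq> g \<Longrightarrow> x \<noteq> g \<Longrightarrow> x \<sqsubseteq> m"
  shows "g \<in> join_irreducibles L"
proof -
  have "g = y \<or> g = z" if "y \<in> carrier L" "z \<in> carrier L" "g = y \<squnion> z" for y z
    using join_left[of y z] join_right[of y z] join_le[of y m z] min[of y] min[of z] assms that
    by metis
  moreover have "\<not> least L g (carrier L)"
    using assms by (auto simp: least_def)
  ultimately show ?thesis
    using assms by (auto simp: join_irreducibles_def)
qed

text \<open>Finiteness gives a maximal element among those above \<open>y\<close> and not above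
  \<open>x\<close>. It is also maximal among all elements not above \<open>x\<close>, hence
  meet-irreducible.\<close>

lemma (in lattice) ex_meet_irreducible_above:
  assumes "finite (carrier L)" "x \<in> carrier L" "y \<in> carrier L" "\<not> x \<sqsubseteq> y"
  shows "\<exists>m\<in>meet_irreducibles L. y \<sqsubseteq> m \<and> \<not> x \<sqsubseteq> m"
proof -
  let ?A = "{z \<in> carrier L. y \<sqsubseteq> z \<and> \<not> x \<sqsubseteq> z}"
  have "\<exists>m\<in>?A. \<forall>z\<in>?A. z \<noteq> m \<longrightarrow> \<not> m \<sqsubset> z"
    by (rule Finite_Set.bex_max_element)
      (use assms in \<open>auto simp: lless_eq asymp_on_def transp_on_def intro: le_trans\<close>)
  then obtain m where m: "m \<in> carrier L" "y \<sqsubseteq> m" "\<not> x \<sqsubseteq> m"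
    and max: "\<And>z. z \<in> carrier L \<Longrightarrow> y \<sqsubseteq> z \<Longrightarrow> \<not> x \<sqsubseteq> z \<Longrightarrow> z \<noteq> m \<Longrightarrow> \<not> m \<sqsubseteq> z"
    by (auto simp: lless_eq)
  have "m \<in> meet_irreducibles L"
    by (rule meet_irreducible_if_maximal_not_above[of x])
      (use m max assms in \<open>blast intro: le_trans\<close>)+
  with m show ?thesis by blast
qed

lemma (in lattice) ex_join_irreducible_below:
  assumes "finite (carrier L)" "x \<in> carrier L" "y \<in> carrier L" "\<not> x \<sqsubseteq> y"
  shows "\<exists>h\<in>join_irreducibles L. h \<sqsubseteq> x \<and> \<not> h \<sqsubseteq> y"
proof -
  let ?A = "{z \<in> carrier L. z \<sqsubseteq> x \<and> \<not> z \<sqsubseteq> y}"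
  have "\<exists>h\<in>?A. \<forall>z\<in>?A. z \<noteq> h \<longrightarrow> \<not> z \<sqsubset> h"
    by (rule Finite_Set.bex_min_element)
      (use assms in \<open>auto simp: lless_eq asymp_on_def transp_on_def intro: le_trans\<close>)
  then obtain h where h: "h \<in> carrier L" "h \<sqsubseteq> x" "\<not> h \<sqsubseteq> y"
    and min: "\<And>z. z \<in> carrier L \<Longrightarrow> z \<sqsubseteq> x \<Longrightarrow> \<not> z \<sqsubseteq> y \<Longrightarrow> z \<noteq> h \<Longrightarrow> \<not> z \<sqsubseteq> h"
    by (auto simp: lless_eq)
  have "h \<in> join_irreducibles L"
    by (rule join_irreducible_if_minimal_not_below[of _ y])
      (use h min assms in \<open>blast intro: le_trans\<close>)+
  with h show ?thesis by blast
qed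

section \<open>Derivations and arrows in terms of the lattice order\<close>

text \<open>Meet-irreducibles separate elements, so inclusion of intents is the reversed order of
  the lattice.\<close>

lemma (in lattice) intent_psubset_iff:
  assumes "finite (carrier L)" "g \<in> carrier L" "h \<in> carrier L"
  shows "intent L g \<subset> intent L h \<longleftrightarrow> h \<sqsubseteq> g \<and> h \<noteq> g"
proof -
  have mono: "intent L u \<subseteq> intent L v \<longleftrightarrow> v \<sqsubseteq> u" if "u \<in> carrier L" "v \<in> carrier L" for u v
  proof
    assume "intent L u \<subseteq> intent L v"
    then show "v \<sqsubseteq> u"
      using ex_meet_irreducible_above[of v u] assms that by (auto simp: intent_def)
  qed (use that in \<open>auto simp: intent_def meet_irreducibles_def intro: le_trans\<close>)
  show ?thesis
    unfolding psubset_eq using mono[of g h] mono[of h g] assms by blast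
qed

lemma (in lattice) extent_psubset_iff:
  assumes "finite (carrier L)" "m \<in> carrier L" "y \<in> carrier L"
  shows "extent L m \<subset> extent L y \<longleftrightarrow> m \<sqsubseteq> y \<and> y \<noteq> m"
proof -
  have mono: "extent L u \<subseteq> extent L v \<longleftrightarrow> u \<sqsubseteq> v" if "u \<in> carrier L" "v \<in> carrier L" for u v
  proof
    assume "extent L u \<subseteq> extent L v"
    then show "u \<sqsubseteq> v"
      using ex_join_irreducible_below[of u v] assms that by (auto simp: extent_def)
  qed (use that in \<open>auto simp: extent_def join_irreducibles_def intro: le_trans\<close>)
  show ?thesis
    unfolding psubset_eq using mono[of m y] mono[of y m] assms by blast
qed

text \<open>Replaces the join-irreducibles in the definition by all elements: if some
  \<open>x\<close> strictly below \<open>g\<close> were not below \<open>m\<close>, a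
  join-irreducible below \<open>x\<close> and not below \<open>m\<close> would violate the
  arrow.\<close>

lemma (in lattice) down_arrow_iff:
  assumes "finite (carrier L)" "g \<in> carrier L" "m \<in> carrier L"
  shows "g \<swarrow>\<^bsub>L\<^esub> m \<longleftrightarrow> \<not> g \<sqsubseteq> m \<and> (\<forall>x\<in>carrier L. x \<sqsubseteq> g \<and> x \<noteq> g \<longrightarrow> x \<sqsubseteq> m)"
proof
  assume arrow: "g \<swarrow>\<^bsub>L\<^esub> m"
  have "x \<sqsubseteq> m" if x: "x \<in> carrier L" "x \<sqsubseteq> g" "x \<noteq> g" for x
  proof (rule ccontr)
    assume "\<not> x \<sqsubseteq> m"
    then obtain h where h: "h \<in> join_irreducibles L" "h \<sqsubseteq> x" "\<not> h \<sqsubseteq> m"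
      using ex_join_irreducible_below[of x m] assms x by blast
    then have "h \<in> carrier L" by (auto simp: join_irreducibles_def)
    with h x have "h \<sqsubseteq> g \<and> h \<noteq> g"
      using assms by (metis le_antisym le_trans)
    then show False
      using arrow h \<open>h \<in> carrier L\<close> assms by (auto simp: down_arrow_def intent_psubset_iff)
  qed
  with arrow show "\<not> g \<sqsubseteq> m \<and> (\<forall>x\<in>carrier L. x \<sqsubseteq> g \<and> x \<noteq> g \<longrightarrow> x \<sqsubseteq> m)"
    by (auto simp: down_arrow_def)
next
  assume min: "\<not> g \<sqsubseteq> m \<and> (\<forall>x\<in>carrier L. x \<sqsubseteq> g \<and> x \<noteq> g \<longrightarrow> x \<sqsubseteq> m)"
  have "h \<sqsubseteq> m" if "h \<in> join_irreducibles L" "intent L g \<subset> intent L h" for h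
    using that min intent_psubset_iff[OF assms(1,2), of h] by (simp add: join_irreducibles_def)
  with min show "g \<swarrow>\<^bsub>L\<^esub> m"
    by (simp add: down_arrow_def)
qed

lemma (in lattice) up_arrow_iff:
  assumes "finite (carrier L)" "g \<in> carrier L" "m \<in> carrier L"
  shows "g \<nearrow>\<^bsub>L\<^esub> m \<longleftrightarrow> \<not> g \<sqsubseteq> m \<and> (\<forall>x\<in>carrier L. m \<sqsubseteq> x \<and> x \<noteq> m \<longrightarrow> g \<sqsubseteq> x)"
proof
  assume arrow: "g \<nearrow>\<^bsub>L\<^esub> m"
  have "g \<sqsubseteq> x" if x: "x \<in> carrier L" "m \<sqsubseteq> x" "x \<noteq> m" for x
  proof (rule ccontr)
    assume "\<not> g \<sqsubseteq> x"
    then obtain y where y: "y \<in> meet_irreducibles L" "x \<sqsubseteq> y" "\<not> g \<sqsubseteq> y"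
      using ex_meet_irreducible_above[of g x] assms x by blast
    then have "y \<in> carrier L" by (auto simp: meet_irreducibles_def)
    with y x have "m \<sqsubseteq> y \<and> y \<noteq> m"
      using assms by (metis le_antisym le_trans)
    then show False
      using arrow y \<open>y \<in> carrier L\<close> assms by (auto simp: up_arrow_def extent_psubset_iff)
  qed
  with arrow show "\<not> g \<sqsubseteq> m \<and> (\<forall>x\<in>carrier L. m \<sqsubseteq> x \<and> x \<noteq> m \<longrightarrow> g \<sqsubseteq> x)"
    by (auto simp: up_arrow_def)
next
  assume max: "\<not> g \<sqsubseteq> m \<and> (\<forall>x\<in>carrier L. m \<sqsubseteq> x \<and> x \<noteq> m \<longrightarrow> g \<sqsubseteq> x)"
  have "g \<sqsubseteq> y" if "y \<in> meet_irreducibles L" "extent L m \<subset> extent L y" for y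
    using that max extent_psubset_iff[OF assms(1,3), of y] by (simp add: meet_irreducibles_def)
  with max show "g \<nearrow>\<^bsub>L\<^esub> m"
    by (simp add: up_arrow_def)
qed


section \<open>Partial sums of partitions\<close>

definition psum :: "nat list \<Rightarrow> nat \<Rightarrow> nat" where
  "psum xs j = sum_list (take j xs)"

text \<open>The default 0 past the end makes the recursion \<open>psum_Suc\<close> hold for every
  \<open>j\<close>.\<close>

definition entry :: "nat list \<Rightarrow> nat \<Rightarrow> nat" where
  "entry xs i = (if i < length xs then xs ! i else 0)"

lemma psum_0 [simp]: "psum xs 0 = 0"
  by (simp add: psum_def)

lemma psum_Suc: "psum xs (Suc j) = psum xs j + entry xs j"
  by (cases "j < length xs") (auto simp: psum_def entry_def take_Suc_conv_app_nth)

lemma psum_append: "psum (xs @ ys) j = psum xs j + psum ys (j - length xs)"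
  by (simp add: psum_def)

lemma psum_Nil [simp]: "psum [] j = 0"
  by (simp add: psum_def)

lemma psum_Cons_Suc: "psum (x # xs) (Suc j) = x + psum xs j"
  by (simp add: psum_def)

lemma psum_replicate [simp]: "psum (replicate m v) j = min j m * v"
  by (simp add: psum_def sum_list_replicate)

lemma psum_ge_length: "length xs \<le> j \<Longrightarrow> psum xs j = sum_list xs"
  by (simp add: psum_def)

lemma psum_mono: "i \<le> j \<Longrightarrow> psum xs i \<le> psum xs j"
  by (rule lift_Suc_mono_le[of "psum xs"]) (auto simp: psum_Suc)

lemma psum_partition_ge: "xs \<in> partitions n \<Longrightarrow> n \<le> j \<Longrightarrow> psum xs j = n"
  by (auto simp: partitions_def psum_ge_length)

lemma psum_partition_le: "xs \<in> partitions n \<Longrightarrow> psum xs j \<le> n"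
  using psum_mono[of j "max j n" xs] psum_partition_ge[of xs n "max j n"] by simp

section \<open>Concavity of partial sums\<close>

lemma entry_antimono:
  assumes "xs \<in> partitions n" "i \<le> j"
  shows "entry xs j \<le> entry xs i"
  using assms by (cases "i = j") (auto simp: partitions_def entry_def sorted_wrt_iff_nth_less)

text \<open>Positions count from 0, so \<open>entry xs p\<close> is the increment from
  \<open>p\<close> to \<open>p + 1\<close>; no later increment exceeds it.\<close>

lemma psum_le_tangent:
  assumes "xs \<in> partitions n" "p \<le> j"
  shows "psum xs j \<le> psum xs p + (j - p) * entry xs p"
  using \<open>p \<le> j\<close>
proof (induction j rule: dec_induct)
  case (step j)
  then show ?case
    using entry_antimono[OF assms(1), of p j] by (simp add: psum_Suc Suc_diff_le)
qed simp

lemma psum_chord_le: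
  assumes "\<And>i. i < p \<Longrightarrow> t \<le> entry xs i" "j \<le> p"
  shows "psum xs j + (p - j) * t \<le> psum xs p"
  using \<open>j \<le> p\<close> assms(1)
proof (induction p rule: dec_induct)
  case (step p)
  then have "psum xs j + (p - j) * t \<le> psum xs p" "t \<le> entry xs p" by simp_all
  then show ?case
    using step.hyps by (simp add: psum_Suc Suc_diff_le)
qed simp

lemma partition_eqI:
  assumes "xs \<in> partitions n" "ys \<in> partitions n" "\<And>j. psum xs j = psum ys j"
  shows "xs = ys"
proof (rule nth_equalityI)
  show "length xs = length ys"
    using assms by (simp add: partitions_def)
  fix i assume "i < length xs"
  moreover have "entry xs i = entry ys i"
    using assms(3)[of i] assms(3)[of "Suc i"] by (simp add: psum_Suc)
  ultimately show "xs ! i = ys ! i"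
    using \<open>length xs = length ys\<close> by (simp add: entry_def)
qed

text \<open>Outside \<open>{1..n}\<close> the partial sums of two partitions agree: both are 0 at 0
  and \<open>n\<close> from \<open>n\<close> on. Dominance thus becomes a pointwise order of
  functions.\<close>

lemma dominated_iff_psum:
  assumes "xs \<in> partitions n" "ys \<in> partitions n"
  shows "dominated n xs ys \<longleftrightarrow> (\<forall>j. psum xs j \<le> psum ys j)"
proof
  assume "dominated n xs ys"
  then have *: "psum xs j \<le> psum ys j" if "j \<in> {1..n}" for j
    using that by (auto simp: dominated_def psum_def)
  show "\<forall>j. psum xs j \<le> psum ys j"
  proof
    fix j
    consider "j = 0" | "j \<in> {1..n}" | "n \<le> j" by force
    then show "psum xs j \<le> psum ys j"
      by cases (use * assms in \<open>auto simp: psum_partition_ge\<close>)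
  qed
qed (auto simp: dominated_def psum_def)

lemma dominated_antisym:
  assumes "xs \<in> partitions n" "ys \<in> partitions n" "dominated n xs ys" "dominated n ys xs"
  shows "xs = ys"
  using assms by (auto simp: dominated_iff_psum intro!: partition_eqI antisym)

text \<open>The differences of \<open>F\<close> serve as entries: concavity makes them weakly
  decreasing, and \<open>F n = n\<close> makes them sum to \<open>n\<close>.\<close>

lemma ex_partition_psum:
  assumes "F 0 = 0" "F n = n" "mono F" "\<And>j. F j + F (j + 2) \<le> 2 * F (j + 1)"
  shows "\<exists>xs\<in>partitions n. \<forall>j\<le>n. psum xs j = F j"
proof
  define d where "d i = F (Suc i) - F i" for i
  define xs where "xs = map d [0..<n]"
  have F_Suc: "F (Suc i) = F i + d i" for i
    using monoD[OF \<open>mono F\<close>, of i "Suc i"] by (simp add: d_def)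
  have "d (Suc i) \<le> d i" for i
    using assms(4)[of i] F_Suc[of i] F_Suc[of "Suc i"] by simp
  then have "antimono d"
    by (intro antimonoI) (rule lift_Suc_antimono_le)
  show psum: "\<forall>j\<le>n. psum xs j = F j"
  proof (intro allI impI)
    fix j assume "j \<le> n"
    then show "psum xs j = F j"
      by (induction j) (auto simp: assms psum_Suc F_Suc entry_def xs_def)
  qed
  have "sum_list xs = n"
    using psum assms by (metis diff_zero length_map length_upt order_refl psum_ge_length xs_def)
  then show "xs \<in> partitions n"
    using \<open>antimono d\<close>
    by (auto simp: partitions_def xs_def sorted_wrt_iff_nth_less antimono_def)
qed

section \<open>The dominance order as a finite complete lattice\<close>

lemma finite_partitions: "finite (partitions n)"
proof (rule finite_subset)
  show "partitions n \<subseteq> {xs. set xs \<subseteq> {..n} \<and> length xs = n}"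
    by (auto simp: partitions_def dest: member_le_sum_list)
qed (rule finite_lists_length_eq, simp)

lemma carrier_partition_lattice [simp]: "carrier (partition_lattice n) = partitions n"
  by (simp add: partition_lattice_def)

lemma le_partition_lattice [simp]: "(\<sqsubseteq>\<^bsub>partition_lattice n\<^esub>) = dominated n"
  by (simp add: partition_lattice_def)

lemma partition_lattice_partial_order: "partial_order (partition_lattice n)"
proof (unfold_locales, goal_cases)
  case (5 x y)
  then show ?case
    by (auto simp: partition_lattice_def intro: dominated_antisym)
next
  case (6 x y z)
  then show ?case
    by (auto simp: dominated_iff_psum intro: order_trans)
qed (auto simp: partition_lattice_def dominated_def)

text \<open>A pointwise minimum of concave functions is concave, so the minima of the partial sums
  over \<open>A\<close> are the partial sums of an infimum of \<open>A\<close>. Given a greatest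
  element, infima of nonempty sets suffice.\<close>

lemma partition_lattice_complete_lattice: "complete_lattice (partition_lattice n)"
proof -
  interpret partial_order "partition_lattice n"
    by (rule partition_lattice_partial_order)
  show ?thesis
  proof (rule complete_lattice_criterion1)
    \<comment> \<open>These are the partial sums of \<open>(n, 0, ..., 0)\<close>, the greatest
      element.\<close>
    have "\<exists>xs\<in>partitions n. \<forall>j\<le>n. psum xs j = (if j = 0 then 0 else n)"
      by (rule ex_partition_psum) (auto intro!: monoI)
    then obtain xs where xs: "xs \<in> partitions n"
      and "\<And>j. j \<le> n \<Longrightarrow> psum xs j = (if j = 0 then 0 else n)" by blast
    then have "psum ys j \<le> psum xs j" if "ys \<in> partitions n" for ys j
      using psum_partition_le[OF that, of j] psum_partition_ge[OF xs, of j]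
      by (cases "j \<le> n") (auto split: if_splits)
    then show "\<exists>g. greatest (partition_lattice n) g (carrier (partition_lattice n))"
      using xs by (auto simp: greatest_def dominated_iff_psum)
  next
    fix A assume "A \<subseteq> carrier (partition_lattice n)" and "A \<noteq> {}"
    then have A: "\<And>x. x \<in> A \<Longrightarrow> x \<in> partitions n" by auto
    define F where "F j = (INF x\<in>A. psum x j)" for j
    have F_le: "F j \<le> psum x j" if "x \<in> A" for x j
      unfolding F_def using that by (intro cINF_lower) auto
    have F_attained: "\<exists>x\<in>A. F j = psum x j" for j
      using Inf_nat_def1[of "(\<lambda>x. psum x j) ` A"] \<open>A \<noteq> {}\<close> by (auto simp: F_def)
    have F_greatest: "c \<le> F j" if "\<And>x. x \<in> A \<Longrightarrow> c \<le> psum x j" for c j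
      using F_attained[of j] that by auto
    have "\<exists>xs\<in>partitions n. \<forall>j\<le>n. psum xs j = F j"
    proof (rule ex_partition_psum)
      show "F 0 = 0" using F_attained[of 0] by auto
      show "F n = n" using F_attained[of n] A by (auto simp: psum_partition_ge)
      show "mono F" by (intro monoI F_greatest) (meson F_le order_trans psum_mono)
      fix j
      \<comment> \<open>The member attaining the minimum in the middle dominates \<open>F\<close> at
        both neighbours, so its own concavity carries over.\<close>
      obtain x where x: "x \<in> A" "F (j + 1) = psum x (j + 1)" using F_attained by blast
      show "F j + F (j + 2) \<le> 2 * F (j + 1)"
        using F_le[OF x(1), of j] F_le[OF x(1), of "j + 2"] x
          entry_antimono[OF A[OF x(1)], of j "Suc j"] by (simp add: psum_Suc)
    qed
    then obtain xs where xs: "xs \<in> partitions n" and psum: "\<And>j. j \<le> n \<Longrightarrow> psum xs j = F j"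
      by blast
    have psum: "psum xs j = F j" for j
      using psum[of j] F_attained[of j] A psum_partition_ge[OF xs, of j] psum_partition_ge[of _ n j]
      by (metis nle_le)
    show "\<exists>i. greatest (partition_lattice n) i (Lower (partition_lattice n) A)"
    proof (intro exI greatest_LowerI)
      fix x assume "x \<in> A"
      then show "xs \<sqsubseteq>\<^bsub>partition_lattice n\<^esub> x"
        using A F_le xs psum by (simp add: dominated_iff_psum)
    next
      fix y assume "y \<in> Lower (partition_lattice n) A"
      then have "y \<in> partitions n" "\<And>x. x \<in> A \<Longrightarrow> dominated n y x"
        using A by (auto simp: Lower_def)
      then show "y \<sqsubseteq>\<^bsub>partition_lattice n\<^esub> xs"
        using A F_greatest xs psum by (simp add: dominated_iff_psum)
    qed (use A xs in auto)
  qed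
qed

section \<open>Arrows between partitions\<close>

lemma partition_down_arrow_iff:
  assumes "g \<in> partitions n" "m \<in> partitions n"
  shows "g \<swarrow>\<^bsub>partition_lattice n\<^esub> m \<longleftrightarrow>
    \<not> dominated n g m \<and> (\<forall>x\<in>partitions n. dominated n x g \<and> x \<noteq> g \<longrightarrow> dominated n x m)"
proof -
  interpret complete_lattice "partition_lattice n"
    by (rule partition_lattice_complete_lattice)
  show ?thesis
    using down_arrow_iff[of g m] assms finite_partitions by simp
qed

lemma partition_up_arrow_iff:
  assumes "g \<in> partitions n" "m \<in> partitions n"
  shows "g \<nearrow>\<^bsub>partition_lattice n\<^esub> m \<longleftrightarrow>
    \<not> dominated n g m \<and> (\<forall>x\<in>partitions n. dominated n m x \<and> x \<noteq> m \<longrightarrow> dominated n g x)"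
proof -
  interpret complete_lattice "partition_lattice n"
    by (rule partition_lattice_complete_lattice)
  show ?thesis
    using up_arrow_iff[of g m] assms finite_partitions by simp
qed

text \<open>The arrows make \<open>g\<close> minimal among the partitions not below
  \<open>m\<close>, and \<open>m\<close> maximal among those not above \<open>g\<close>;
  irreducibility follows from this.\<close>

lemma partition_irreducible_if_arrows:
  assumes g: "g \<in> partitions n" and m: "m \<in> partitions n"
    and down: "g \<swarrow>\<^bsub>partition_lattice n\<^esub> m" and up: "g \<nearrow>\<^bsub>partition_lattice n\<^esub> m"
  shows "g \<in> join_irreducibles (partition_lattice n)"
    and "m \<in> meet_irreducibles (partition_lattice n)"
proof -
  interpret complete_lattice "partition_lattice n"
    by (rule partition_lattice_complete_lattice)
  show "g \<in> join_irreducibles (partition_lattice n)"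
    using join_irreducible_if_minimal_not_below[of g m] down partition_down_arrow_iff[OF g m] g m
    by simp
  show "m \<in> meet_irreducibles (partition_lattice n)"
    using meet_irreducible_if_maximal_not_above[of g m] up partition_up_arrow_iff[OF g m] g m
    by simp
qed


section \<open>Partitions of types D and IV\<close>

lemma psum_tuple: "psum (tuple n xs) j = psum xs j"
  by (simp add: tuple_def psum_append)

lemma psum_shape_D:
  "psum (shape_D b k l d) j = min j b * (k + 1) + min (j - b) l * k + min (j - b - l) d"
  by (simp add: shape_D_def psum_append)

lemma sorted_wrt_replicate: "R v v \<Longrightarrow> sorted_wrt R (replicate m v)"
  by (induction m) auto

lemma tuple_shape_D_partition:
  assumes "k \<ge> 1" "n = b * (k + 1) + l * k + d"
  shows "tuple n (shape_D b k l d) \<in> partitions n"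
proof -
  \<comment> \<open>All entries written out are positive, so there are at most \<open>n\<close> of
    them and padding gives length exactly \<open>n\<close>.\<close>
  have "b \<le> b * (k + 1)" "l \<le> l * k" using assms by simp_all
  then have "b + l + d \<le> n" using assms by linarith
  then show ?thesis
    using assms
    by (auto simp: partitions_def tuple_def shape_D_def sorted_wrt_append sum_list_replicate
        sorted_wrt_replicate)
qed

lemma tuple_shape_D_partitionD:
  assumes "tuple n (shape_D b k l d) \<in> partitions n"
  shows "n = b * (k + 1) + l * k + d"
  using assms by (simp add: partitions_def tuple_def shape_D_def sum_list_replicate)

text \<open>The unique lower cover of \<open>g\<close> arises by moving one unit from the last entry \<open>k\<close> to the
  first entry \<open>1\<close>.\<close>

lemma ex_lower_cover_shape_D:
  assumes "k \<ge> 3" "l \<ge> 1" "d \<ge> 1" "n = b * (k + 1) + l * k + d"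
  shows "\<exists>h\<in>partitions n. \<forall>j. psum h j =
    (if j = b + l then psum (shape_D b k l d) j - 1 else psum (shape_D b k l d) j)"
proof -
  obtain l' d' where [simp]: "l = Suc l'" "d = Suc d'"
    using assms by (metis Suc_le_D One_nat_def)
  define us where "us = replicate b (k + 1) @ replicate l' k"
  \<comment> \<open>The pair \<open>k, 1\<close> at the corner becomes \<open>k - 1, 2\<close>; by
    \<open>k \<ge> 3\<close> the entries still decrease weakly.\<close>
  define hs where "hs = us @ [k - 1, 2] @ replicate d' 1"
  have g: "shape_D b k l d = us @ [k, 1] @ replicate d' 1"
    by (simp add: shape_D_def us_def flip: replicate_append_same)
  have len: "length us = b + l'" by (simp add: us_def)
  have psum: "psum hs j =
      (if j = b + l then psum (shape_D b k l d) j - 1 else psum (shape_D b k l d) j)" for j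
  proof -
    consider "j \<le> b + l'" | "j = Suc (b + l')" | i where "j = b + l' + Suc (Suc i)"
      using that less_imp_Suc_add[of "Suc (b + l')" j]
      by (cases "j \<le> Suc (b + l')") (auto simp: le_Suc_eq)
    then show ?thesis
      unfolding g hs_def using \<open>k \<ge> 3\<close>
      by cases (simp_all add: psum_append len psum_Cons_Suc)
  qed
  have "b \<le> b * (k + 1)" "l \<le> l * k" using assms by (cases k; simp)+
  then have "b + l + d \<le> n" using assms by linarith
  then have "tuple n hs \<in> partitions n"
    using assms
    by (auto simp: partitions_def tuple_def hs_def us_def sorted_wrt_append sum_list_replicate
        sorted_wrt_replicate)
  with psum show ?thesis
    by (metis psum_tuple)
qed

text \<open>A partition \<open>x\<close> falling short of \<open>g\<close> at some \<open>j\<close>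
  also falls short at \<open>b + l\<close>. For \<open>j\<close> before the corner, the entries of
  \<open>x\<close> from \<open>j\<close> on are too small to catch up; for \<open>j\<close> after
  it, the entries of \<open>x\<close> up to \<open>j\<close> are positive, so going back to the
  corner loses at least as much as \<open>g\<close> does.\<close>

lemma shape_D_dominated_iff:
  assumes "k \<ge> 1" "n = b * (k + 1) + l * k + d" and x: "x \<in> partitions n"
  shows "dominated n (tuple n (shape_D b k l d)) x \<longleftrightarrow> b * (k + 1) + l * k \<le> psum x (b + l)"
proof
  assume "dominated n (tuple n (shape_D b k l d)) x"
  then have "psum (shape_D b k l d) (b + l) \<le> psum x (b + l)"
    using dominated_iff_psum[OF tuple_shape_D_partition x] assms by (auto simp: psum_tuple)
  then show "b * (k + 1) + l * k \<le> psum x (b + l)"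
    by (simp add: psum_shape_D)
next
  assume p: "b * (k + 1) + l * k \<le> psum x (b + l)"
  have "psum (shape_D b k l d) j \<le> psum x j" for j
  proof (rule ccontr)
    assume "\<not> psum (shape_D b k l d) j \<le> psum x j"
    then have less: "psum x j < psum (shape_D b k l d) j" by simp
    show False
    proof (cases "j \<le> b + l")
      case True
      then have less: "psum x j < j * k + min j b"
        using less by (cases "j \<le> b") (auto simp: psum_shape_D algebra_simps)
      \<comment> \<open>Otherwise all entries before \<open>j\<close> are at least
        \<open>k + 1\<close>, and \<open>psum x j\<close> would be at least
        \<open>j * (k + 1)\<close>.\<close>
      have "entry x j \<le> k"
      proof (rule ccontr)
        assume "\<not> entry x j \<le> k"
        then have "k + 1 \<le> entry x i" if "i < j" for i
          using entry_antimono[OF x, of i j] that by simp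
        from psum_chord_le[OF this, of j 0] less show False by (simp add: algebra_simps)
      qed
      then have "psum x (b + l) \<le> psum x j + (b + l - j) * k"
        using psum_le_tangent[OF x True] by (meson add_left_mono mult_le_mono2 order_trans)
      also have "\<dots> < j * k + b + (b + l - j) * k" using less by simp
      also have "\<dots> = b * (k + 1) + l * k"
      proof -
        have "j * k + (b + l - j) * k = (b + l) * k" using True by (simp flip: add_mult_distrib)
        then show ?thesis by (simp add: algebra_simps)
      qed
      finally show False using p by simp
    next
      case False
      then have less: "psum x j < b * (k + 1) + l * k + min (j - (b + l)) d"
        using less by (simp add: psum_shape_D)
      then have "psum x j < n" using assms by simp
      \<comment> \<open>A zero entry would freeze the partial sums at a value below
        \<open>n\<close>.\<close>
      have "entry x j \<noteq> 0"
      proof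
        assume "entry x j = 0"
        then have "psum x (max j n) \<le> psum x j"
          using psum_le_tangent[OF x, of j "max j n"] by simp
        with \<open>psum x j < n\<close> show False using psum_partition_ge[OF x, of "max j n"] by simp
      qed
      then have *: "1 \<le> entry x i" if "i < j" for i
        using entry_antimono[OF x, of i j] that by simp
      have "psum x (b + l) + (j - (b + l)) \<le> psum x j"
        using psum_chord_le[OF *, of j "b + l"] False by simp
      with less p show False by simp
    qed
  qed
  then show "dominated n (tuple n (shape_D b k l d)) x"
    using dominated_iff_psum[OF tuple_shape_D_partition x] assms by (simp add: psum_tuple)
qed

section \<open>Type IV as a truncated line\<close>

text \<open>The last entry \<open>r < t\<close> is what remains when the next full step of the line
  would pass \<open>n\<close>. At \<open>j = 0\<close> the truncated \<open>j - 1\<close> would give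
  \<open>min n a\<close>, hence \<open>j \<ge> 1\<close>.\<close>

lemma psum_shape_IV:
  assumes "n = a + c * t + r" "r < t" "j \<ge> 1"
  shows "psum (shape_IV a t c r) j = min n (a + (j - 1) * t)"
proof -
  obtain i where [simp]: "j = Suc i" using assms by (cases j) auto
  have "psum (shape_IV a t c r) j = a + min i c * t + psum [r] (i - c)"
    by (simp add: shape_IV_def psum_append psum_def sum_list_replicate)
  also have "\<dots> = min n (a + i * t)"
  proof (cases "i \<le> c")
    case True
    from mult_le_mono1[OF this, of t] have "a + i * t \<le> n" using assms(1) by linarith
    with True show ?thesis by simp
  next
    case False
    then have "Suc c * t \<le> i * t" by (intro mult_le_mono1) simp
    then have "c * t + r \<le> i * t" using \<open>r < t\<close> by simp
    moreover have "psum [r] (i - c) = r" using False by (simp add: psum_ge_length)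
    ultimately show ?thesis using False assms by simp
  qed
  finally show ?thesis by simp
qed

lemma tuple_shape_IV_partition:
  assumes "n = a + c * t + r" "r < t" "t < a"
  shows "tuple n (shape_IV a t c r) \<in> partitions n"
proof -
  have "c \<le> c * t" using assms by simp
  then have "c + 2 \<le> n" using assms by linarith
  then show ?thesis
    using assms
    by (auto simp: partitions_def tuple_def shape_IV_def sorted_wrt_append sum_list_replicate
        sorted_wrt_replicate)
qed

text \<open>The slope \<open>t\<close> lies between the increments of \<open>psum x\<close> just
  before and just after \<open>p\<close>. By concavity \<open>psum x\<close> stays below the line of
  slope \<open>t\<close> through its value at \<open>p\<close>, hence below
  \<open>a + (j - 1) * t\<close>; it also stays below \<open>n\<close>.\<close>

lemma dominated_shape_IV:
  assumes "n = a + c * t + r" "r < t" "t < a" and x: "x \<in> partitions n"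
    and p: "p \<ge> 1" "psum x p \<le> a + (p - 1) * t"
    and entries: "t \<le> entry x (p - 1)" "entry x p \<le> t"
  shows "dominated n x (tuple n (shape_IV a t c r))"
proof -
  have "psum x j \<le> a + (j - 1) * t" if "j \<ge> 1" for j
  proof (cases "j \<le> p")
    case True
    have "t \<le> entry x i" if "i < p" for i
    proof -
      have "i \<le> p - 1" using that by simp
      from entry_antimono[OF x this] entries show ?thesis by simp
    qed
    from psum_chord_le[OF this True] have "psum x j + (p - j) * t \<le> a + (p - 1) * t"
      using p by simp
    moreover have "(p - 1) * t = (p - j) * t + (j - 1) * t"
      using True that by (simp flip: add_mult_distrib)
    ultimately show ?thesis by simp
  next
    case False
    then have "psum x j \<le> psum x p + (j - p) * entry x p"
      by (intro psum_le_tangent[OF x]) simp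
    also have "\<dots> \<le> a + (p - 1) * t + (j - p) * t"
      using p entries by (intro add_mono mult_le_mono) auto
    also have "\<dots> = a + (j - 1) * t"
      using False p by (simp flip: add_mult_distrib)
    finally show ?thesis .
  qed
  moreover have "psum x j \<le> n" for j by (rule psum_partition_le[OF x])
  ultimately have "psum x j \<le> psum (shape_IV a t c r) j" for j
    using psum_shape_IV[OF assms(1,2), of j] by (cases "j = 0") auto
  then show ?thesis
    using dominated_iff_psum[OF x tuple_shape_IV_partition] assms by (simp add: psum_tuple)
qed


section \<open>The double arrows\<close>

text \<open>This is \<open>a + (p - 1) t = q\<close> with \<open>p = b + l\<close>, the reason for the choice of \<open>a\<close>.\<close>

lemma tangent_at_corner:
  fixes b l k t :: nat
  assumes "t \<le> k" "b + l \<ge> 1" "t \<ge> 1"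
  shows "b + (b + l) * (k - t) + t - 1 + (b + l - 1) * t = b * (k + 1) + l * k - 1"
proof -
  have "(b + l) * (k - t) + (b + l) * t = (b + l) * k"
    using assms by (simp flip: add_mult_distrib2)
  moreover have "t + (b + l - 1) * t = (b + l) * t"
    using assms by (cases "b + l") auto
  moreover have "b * (k + 1) + l * k = b + (b + l) * k"
    by (simp add: algebra_simps)
  ultimately show ?thesis using assms by simp
qed

text \<open>The product is at least 2, which outweighs the final \<open>- 1\<close>.\<close>

lemma shape_IV_bound:
  fixes b l k t :: nat
  assumes "t < k" "b + l \<ge> 2"
  shows "t < b + (b + l) * (k - t) + t - 1"
proof -
  obtain u where "k - t = Suc u" using \<open>t < k\<close> by (metis Suc_diff_Suc)
  with assms show ?thesis by simp
qed

text \<open>At the corner \<open>b + l\<close> the partial sum of \<open>m\<close> is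
  \<open>q\<close>, one less than that of \<open>g\<close>, and elsewhere \<open>m\<close> is at
  least \<open>g\<close>. So whatever is strictly below \<open>g\<close> is below \<open>m\<close>.
  Conversely, a partition above \<open>m\<close> but not above \<open>g\<close> is held to the line
  of slope \<open>t\<close> at the corner and therefore equals \<open>m\<close>.\<close>

lemma double_arrow_shape_IV:
  assumes k: "k \<ge> 3" and d: "d \<ge> 1" and l: "l \<ge> 1" and bl: "b + l \<ge> 2"
    and n: "n = b * (k + 1) + l * k + d"
    and t: "2 \<le> t" "t \<le> k - 1" "t \<le> d + 1"
    and a: "a = b + (b + l) * (k - t) + t - 1"
    and cr: "n - a = c * t + r" "r < t"
  defines "g \<equiv> tuple n (shape_D b k l d)" and "m \<equiv> tuple n (shape_IV a t c r)"
  shows "a \<le> n" "c \<ge> 2" "t < a" "g \<in> partitions n" "m \<in> partitions n"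
    "g \<swarrow>\<^bsub>partition_lattice n\<^esub> m" "g \<nearrow>\<^bsub>partition_lattice n\<^esub> m"
proof -
  have "k \<le> l * k" using l by simp
  define q where "q = b * (k + 1) + l * k - 1"
  have q: "b * (k + 1) + l * k = q + 1"
    using \<open>k \<le> l * k\<close> k by (simp add: q_def)
  have corner: "a + (b + l - 1) * t = q"
    unfolding a q_def by (rule tangent_at_corner) (use t k bl in auto)
  have "n = q + 1 + d" using n q by simp
  then show "a \<le> n" using corner by simp
  then have n': "n = a + c * t + r" using cr by simp
  show "t < a"
    unfolding a by (rule shape_IV_bound) (use t k bl in auto)
  \<comment> \<open>If \<open>c \<le> 1\<close>, then
    \<open>n \<le> a + t + r \<le> q + r < q + t \<le> q + 1 + d = n\<close>.\<close>
  show "c \<ge> 2"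
  proof (rule ccontr)
    assume "\<not> c \<ge> 2"
    then have "c * t \<le> 1 * t" by (intro mult_le_mono1) simp
    moreover have "1 * t \<le> (b + l - 1) * t" using bl by (intro mult_le_mono1) simp
    ultimately show False
      using corner n' \<open>n = q + 1 + d\<close> t cr by linarith
  qed
  show g: "g \<in> partitions n"
    unfolding g_def by (rule tuple_shape_D_partition) (use k n in auto)
  show m: "m \<in> partitions n"
    unfolding m_def by (rule tuple_shape_IV_partition) (use n' cr \<open>t < a\<close> in auto)
  have above_iff: "dominated n g x \<longleftrightarrow> q < psum x (b + l)" if "x \<in> partitions n" for x
    unfolding g_def using shape_D_dominated_iff[OF _ n that] k q by (simp add: Suc_le_eq)
  have psum_m: "psum m j = min n (a + (j - 1) * t)" if "j \<ge> 1" for j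
    unfolding m_def psum_tuple by (rule psum_shape_IV[OF n' cr(2) that])
  have psum_m_p: "psum m (b + l) = q"
    using psum_m[of "b + l"] corner bl \<open>n = q + 1 + d\<close> by simp
  then have not_le: "\<not> dominated n g m"
    using above_iff[OF m] by simp
  \<comment> \<open>One step away from the corner already makes up the deficit of 1: going back,
    \<open>g\<close> loses at least \<open>k\<close> per step and \<open>m\<close> only
    \<open>t \<le> k - 1\<close>; going forward, \<open>g\<close> gains at most 1 per step and
    \<open>m\<close> gains \<open>t \<ge> 2\<close> until it reaches \<open>n\<close>.\<close>
  have psum_g_m: "psum g j \<le> psum m j" if "j \<noteq> b + l" for j
  proof (cases "j < b + l")
    case True
    show ?thesis
    proof (cases "j = 0")
      case False
      obtain i where i: "b + l = j + Suc i" using True by (metis less_iff_Suc_add add_Suc_right)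
      have "psum g j \<le> j * k + b"
        using True unfolding g_def psum_tuple psum_shape_D
        by (cases "j \<le> b") (auto simp: algebra_simps)
      also have "\<dots> + Suc i * k = q + 1"
      proof -
        have "(b + l) * k = j * k + Suc i * k" by (simp only: i add_mult_distrib)
        then show ?thesis using q by (simp add: algebra_simps)
      qed
      finally have "psum g j + Suc i * k \<le> q + 1" by simp
      moreover have "(b + l - 1) * t = (j - 1) * t + Suc i * t"
        using False by (cases j) (simp_all add: i flip: add_mult_distrib)
      moreover have "Suc i * t + Suc i \<le> Suc i * k"
      proof -
        have "t + 1 \<le> k" using t k by simp
        from mult_le_mono2[OF this, of "Suc i"] show ?thesis by simp
      qed
      moreover have "psum g j \<le> n" by (rule psum_partition_le[OF g])
      ultimately show ?thesis
        using psum_m[of j] corner False by simp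
    qed simp
  next
    case False
    with that have "b + l < j" by simp
    then obtain i where i: "j = b + l + Suc i" by (auto dest: less_imp_Suc_add)
    have "Suc i + 1 \<le> Suc i * t"
      by (rule order_trans[OF _ mult_le_mono2[OF t(1)]]) simp
    moreover have "(j - 1) * t = (b + l - 1) * t + Suc i * t"
    proof -
      have "j - 1 = (b + l - 1) + Suc i" using bl i by simp
      then show ?thesis by (simp only: add_mult_distrib)
    qed
    moreover have "psum g j = q + 1 + min (Suc i) d"
      using q unfolding g_def psum_tuple psum_shape_D by (simp add: i)
    ultimately show ?thesis
      using psum_m[of j] corner i \<open>n = q + 1 + d\<close> by simp
  qed
  have "dominated n x m" if x: "x \<in> partitions n" "dominated n x g" "x \<noteq> g" for x
  proof -
    have xg: "psum x j \<le> psum g j" for j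
      using x g by (simp add: dominated_iff_psum)
    have "\<not> dominated n g x"
      using x g dominated_antisym by blast
    then have "psum x (b + l) \<le> psum m (b + l)"
      using above_iff[OF x(1)] psum_m_p by simp
    then have "psum x j \<le> psum m j" for j
      using xg[of j] psum_g_m[of j] by (cases "j = b + l") auto
    then show ?thesis
      using x m by (simp add: dominated_iff_psum)
  qed
  then show "g \<swarrow>\<^bsub>partition_lattice n\<^esub> m"
    using partition_down_arrow_iff[OF g m] not_le by blast
  have "dominated n g x" if x: "x \<in> partitions n" "dominated n m x" "x \<noteq> m" for x
  proof (rule ccontr)
    assume "\<not> dominated n g x"
    then have p: "psum x (b + l) \<le> q" using above_iff[OF x(1)] by simp
    have mx: "psum m j \<le> psum x j" for j
      using x m by (simp add: dominated_iff_psum)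
    obtain i where i: "b + l = Suc (Suc i)"
      using bl by (metis Suc_le_D numeral_2_eq_2 Suc_le_mono)
    have qi: "a + (i * t + t) = q" using corner i by simp
    \<comment> \<open>The neighbours of the corner \<open>b + l = i + 2\<close>. By
      \<open>t \<le> d + 1\<close> the value \<open>q + t\<close> is not cut off at
      \<open>n\<close>, so both increments of \<open>m\<close> at the corner are exactly
      \<open>t\<close>.\<close>
    have m_before: "psum m (Suc i) = a + i * t" and m_after: "psum m (Suc (Suc (Suc i))) = q + t"
      using psum_m[of "Suc i"] psum_m[of "Suc (Suc (Suc i))"] qi \<open>n = q + 1 + d\<close> t by auto
    have "entry x (Suc i) \<le> t"
      using mx[of "Suc i"] m_before p qi i psum_Suc[of x "Suc i"] by simp
    moreover have "t \<le> entry x (Suc (Suc i))"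
      using mx[of "Suc (Suc (Suc i))"] m_after p i psum_Suc[of x "Suc (Suc i)"] by simp
    moreover have "entry x (Suc (Suc i)) \<le> entry x (Suc i)"
      by (rule entry_antimono[OF x(1)]) simp
    ultimately have "dominated n x m"
      unfolding m_def
      by (intro dominated_shape_IV[where p = "b + l"])
        (use n' cr \<open>t < a\<close> x p corner i in auto)
    with x m have "x = m"
      by (blast intro: dominated_antisym)
    with x show False by simp
  qed
  then show "g \<nearrow>\<^bsub>partition_lattice n\<^esub> m"
    using partition_up_arrow_iff[OF g m] not_le by blast
qed

text \<open>The slope \<open>t\<close> is read off from \<open>m\<close> just after the corner. The
  type IV partition on the line with this slope lies above \<open>m\<close> but not above
  \<open>g\<close>, so it is \<open>m\<close> by maximality. The bounds \<open>2 \<le> t\<close> and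
  \<open>t \<le> k - 1\<close> come from the lower cover \<open>h\<close> of \<open>g\<close>, which
  must lie below \<open>m\<close>.\<close>

lemma shape_IV_if_double_arrow:
  fixes n :: nat
  assumes k: "k \<ge> 3" and d: "d \<ge> 1" and l: "l \<ge> 1" and bl: "b + l \<ge> 2"
  defines "g \<equiv> tuple n (shape_D b k l d)"
  assumes g: "g \<in> partitions n" and m: "m \<in> partitions n"
    and down: "g \<swarrow>\<^bsub>partition_lattice n\<^esub> m" and up: "g \<nearrow>\<^bsub>partition_lattice n\<^esub> m"
  shows "\<exists>t a c r. 2 \<le> t \<and> t \<le> min (k - 1) (d + 1) \<and> a = b + (b + l) * (k - t) + t - 1 \<and>
    a \<le> n \<and> n - a = c * t + r \<and> r < t \<and> m = tuple n (shape_IV a t c r)"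
proof -
  have n: "n = b * (k + 1) + l * k + d"
    using g unfolding g_def by (rule tuple_shape_D_partitionD)
  have "k \<le> l * k" using l by simp
  define q where "q = b * (k + 1) + l * k - 1"
  have q: "b * (k + 1) + l * k = q + 1"
    using \<open>k \<le> l * k\<close> k by (simp add: q_def)
  have nq: "n = q + 1 + d" using n q by simp
  have above_iff: "dominated n g x \<longleftrightarrow> q < psum x (b + l)" if "x \<in> partitions n" for x
    unfolding g_def using shape_D_dominated_iff[OF _ n that] k q by (simp add: Suc_le_eq)
  have not_le: "\<not> dominated n g m"
    and below: "\<And>x. x \<in> partitions n \<Longrightarrow> dominated n x g \<Longrightarrow> x \<noteq> g \<Longrightarrow> dominated n x m"
    and above: "\<And>x. x \<in> partitions n \<Longrightarrow> dominated n m x \<Longrightarrow> x \<noteq> m \<Longrightarrow> dominated n g x"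
    using down up partition_down_arrow_iff[OF g m] partition_up_arrow_iff[OF g m] by auto
  have psum_g: "psum g j = psum (shape_D b k l d) j" for j
    by (simp add: g_def psum_tuple)
  \<comment> \<open>Here the corner is \<open>Suc p\<close>, so \<open>entry m p\<close> and
    \<open>entry m (Suc p)\<close> are the increments on its two sides.\<close>
  obtain p where p: "b + l = Suc p" "p \<ge> 1" using bl by (cases "b + l") auto
  have g_before: "psum g p + k = q + 1" and g_p: "psum g (Suc p) = q + 1"
    and g_after: "psum g (Suc (Suc p)) = q + 2"
  proof -
    obtain l' where l': "l = Suc l'" using l by (cases l) auto
    then have "p = b + l'" using p by simp
    then show "psum g p + k = q + 1" "psum g (Suc p) = q + 1" "psum g (Suc (Suc p)) = q + 2"
      using q d l' by (auto simp: psum_g psum_shape_D)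
  qed
  obtain h where h: "h \<in> partitions n"
    and psum_h: "\<And>j. psum h j = (if j = b + l then psum g j - 1 else psum g j)"
    using ex_lower_cover_shape_D[OF k l d n] psum_g by auto
  have "h \<noteq> g" using psum_h[of "b + l"] g_p p by auto
  moreover have "dominated n h g" using h g psum_h by (simp add: dominated_iff_psum)
  ultimately have hm: "psum h j \<le> psum m j" for j
    using below[OF h] dominated_iff_psum[OF h m] by blast
  \<comment> \<open>At least \<open>q\<close> because \<open>h\<close> lies below \<open>m\<close>,
    at most \<open>q\<close> because \<open>m\<close> is not above \<open>g\<close>.\<close>
  have m_p: "psum m (Suc p) = q"
    using hm[of "Suc p"] psum_h[of "Suc p"] g_p above_iff[OF m] not_le p by simp
  define t where "t = entry m (Suc p)"
  have m_after: "psum m (Suc (Suc p)) = q + t"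
    using m_p by (simp add: t_def psum_Suc[of m "Suc p"])
  have t_le: "t \<le> entry m p" unfolding t_def by (rule entry_antimono[OF m]) simp
  have "entry m p + 1 \<le> k"
    using hm[of p] psum_h[of p] g_before m_p p by (simp add: psum_Suc)
  then have "t \<le> k - 1" using t_le by simp
  have "2 \<le> t"
    using hm[of "Suc (Suc p)"] psum_h[of "Suc (Suc p)"] g_after m_after p by simp
  \<comment> \<open>The sum \<open>q + t\<close> up to the entry after the corner cannot exceed
    \<open>n = q + 1 + d\<close>.\<close>
  have "t \<le> d + 1"
    using psum_partition_le[OF m, of "Suc (Suc p)"] m_after nq by simp
  define a where "a = b + (b + l) * (k - t) + t - 1"
  have corner: "a + p * t = q"
    using tangent_at_corner[of t k b l] \<open>t \<le> k - 1\<close> \<open>2 \<le> t\<close> k bl p by (simp add: a_def q_def)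
  have "t < a"
    unfolding a_def by (rule shape_IV_bound) (use \<open>t \<le> k - 1\<close> k bl in auto)
  have "a \<le> n" using corner nq by simp
  define c where "c = (n - a) div t"
  define r where "r = (n - a) mod t"
  have "r < t" and cr: "n - a = c * t + r"
    using \<open>2 \<le> t\<close> by (auto simp: r_def c_def)
  then have n': "n = a + c * t + r" using \<open>a \<le> n\<close> by simp
  let ?y = "tuple n (shape_IV a t c r)"
  have y: "?y \<in> partitions n"
    by (rule tuple_shape_IV_partition[OF n' \<open>r < t\<close> \<open>t < a\<close>])
  have "dominated n m ?y"
    by (rule dominated_shape_IV[OF n' \<open>r < t\<close> \<open>t < a\<close> m, where p = "Suc p"])
      (use m_p corner t_le t_def in auto)
  \<comment> \<open>At the corner the line has the value \<open>a + p * t = q\<close>, one too small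
    for \<open>g\<close>.\<close>
  moreover have "\<not> dominated n g ?y"
    using above_iff[OF y] psum_shape_IV[OF n' \<open>r < t\<close>, of "Suc p"] corner p
    by (simp add: psum_tuple)
  ultimately have "m = ?y" using above[OF y] by blast
  with \<open>2 \<le> t\<close> \<open>t \<le> k - 1\<close> \<open>t \<le> d + 1\<close> \<open>a \<le> n\<close> cr \<open>r < t\<close> show ?thesis
    by (intro exI[of _ t] exI[of _ a] exI[of _ c] exI[of _ r]) (simp add: a_def)
qed

theorem theorem4p23:
  shows
    "(\<forall>b k d l n t a c r :: nat.
        k \<ge> 3 \<and> d \<ge> 1 \<and> l \<ge> 1 \<and> b + l \<ge> 2 \<and> n = b * (k + 1) + l * k + d \<and>
        2 \<le> t \<and> t \<le> min (k - 1) (d + 1) \<and>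
        a = b + (b + l) * (k - t) + t - 1 \<and>
        n - a = c * t + r \<and> r < t \<longrightarrow>
        (let L = partition_lattice n;
             g = tuple n (shape_D b k l d);
             m = tuple n (shape_IV a t c r)
         in a \<le> n \<and> g \<in> join_irreducibles L \<and> m \<in> meet_irreducibles L \<and> type_IV n m \<and>
            g \<swarrow>\<^bsub>L\<^esub> m \<and> g \<nearrow>\<^bsub>L\<^esub> m)) \<and>
     (\<forall>n g m.
        type_D n g \<and> m \<in> meet_irreducibles (partition_lattice n) \<and>
        g \<swarrow>\<^bsub>partition_lattice n\<^esub> m \<and> g \<nearrow>\<^bsub>partition_lattice n\<^esub> m \<longrightarrow>
        (\<forall>b k d l :: nat.
           k \<ge> 3 \<and> d \<ge> 1 \<and> l \<ge> 1 \<and> b + l \<ge> 2 \<and> g = tuple n (shape_D b k l d) \<longrightarrow>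
           (\<exists>t a c r :: nat.
              2 \<le> t \<and> t \<le> min (k - 1) (d + 1) \<and>
              a = b + (b + l) * (k - t) + t - 1 \<and>
              a \<le> n \<and> n - a = c * t + r \<and> r < t \<and>
              m = tuple n (shape_IV a t c r))))"
proof (rule conjI; intro allI impI)
  fix b k d l n t a c r :: nat
  assume "k \<ge> 3 \<and> d \<ge> 1 \<and> l \<ge> 1 \<and> b + l \<ge> 2 \<and> n = b * (k + 1) + l * k + d \<and>
    2 \<le> t \<and> t \<le> min (k - 1) (d + 1) \<and> a = b + (b + l) * (k - t) + t - 1 \<and>
    n - a = c * t + r \<and> r < t"
  then have asms: "k \<ge> 3" "d \<ge> 1" "l \<ge> 1" "b + l \<ge> 2" "n = b * (k + 1) + l * k + d"
    "2 \<le> t" "t \<le> k - 1" "t \<le> d + 1" "a = b + (b + l) * (k - t) + t - 1"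
    "n - a = c * t + r" "r < t"
    unfolding min.bounded_iff by blast+
  note arrow = double_arrow_shape_IV[OF asms]
  note irr = partition_irreducible_if_arrows[OF arrow(4-7)]
  have "type_IV n (tuple n (shape_IV a t c r))"
    unfolding type_IV_def using irr(2) arrow(2,3) asms(6,11) by blast
  with arrow irr show "let L = partition_lattice n;
             g = tuple n (shape_D b k l d);
             m = tuple n (shape_IV a t c r)
         in a \<le> n \<and> g \<in> join_irreducibles L \<and> m \<in> meet_irreducibles L \<and> type_IV n m \<and>
            g \<swarrow>\<^bsub>L\<^esub> m \<and> g \<nearrow>\<^bsub>L\<^esub> m"
    by (simp add: Let_def)
next
  fix n g m and b k d l :: nat
  assume *: "type_D n g \<and> m \<in> meet_irreducibles (partition_lattice n) \<and>
    g \<swarrow>\<^bsub>partition_lattice n\<^esub> m \<and> g \<nearrow>\<^bsub>partition_lattice n\<^esub> m"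
    "k \<ge> 3 \<and> d \<ge> 1 \<and> l \<ge> 1 \<and> b + l \<ge> 2 \<and> g = tuple n (shape_D b k l d)"
  then have "g \<in> partitions n" "m \<in> partitions n"
    by (auto simp: type_D_def join_irreducibles_def meet_irreducibles_def)
  with * show "\<exists>t a c r :: nat.
              2 \<le> t \<and> t \<le> min (k - 1) (d + 1) \<and>
              a = b + (b + l) * (k - t) + t - 1 \<and>
              a \<le> n \<and> n - a = c * t + r \<and> r < t \<and>
              m = tuple n (shape_IV a t c r)"
    by (intro shape_IV_if_double_arrow) auto
qed

end
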